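(* Let $\Delta$ be a simplicial complex on the vertex set $[n]=\{1,\dots,n\}$, let $i\in[n]$ be a player, let $0\le\lambda_i\le 1$, and let $\phi_i:\mathbb{R}(\Delta)\to\mathbb{R}$ be an individual value for $i$. Then $\phi_i$ is an $\mathbb{R}$-linear function satisfying the $\lambda_i$-Dummy axiom and the Monotonicity axiom if and only if there exists a collection of non-negative real numbers $\{p^i_T : T\in \operatorname{Lk}_\Delta(i)\}$ with \[\sum_{T\in \operatorname{Lk}_\Delta(i)} p^i_T=\lambda_i\] such that for all $v\in\mathbb{R}(\Delta)$, \[\phi_i(v)=\sum_{T\in \operatorname{Lk}_\Delta(i)} p^i_T\,\bigl(v(T\cup\{i\})-v(T)\bigr).\]
   Context: A (finite) simplicial complex $\Delta$ on $[n]$ is a family of subsets of $[n]$ such that if $T\in\Delta$ and $S\subseteq T$ then $S\in\Delta$. A cooperative game on $\Delta$ is a function $v:\Delta\to\mathbb{R}$ with $v(\emptyset)=0$; the set of all such games is the real vector space $\mathbb{R}(\Delta)$. An individual value for a player $i\in[n]$ is a function $\phi_i:\mathbb{R}(\Delta)\to\mathbb{R}$. The link of $i$ is $\operatorname{Lk}_\Delta(i)=\{T\in\Delta : i\notin T,\ T\cup\{i\}\in\Delta\}$. A player $i$ is dummy for $v$ if $v(S\cup\{i\})=v(S)+v(\{i\})$ for every $S$ with $i\notin S$ and $S\cup\{i\}\in\Delta$. The game $v$ is monotone if $S\subseteq T\in\Delta$ implies $v(S)\le v(T)$. $\lambda_i$-Dummy axiom: if $i$ is dummy for $v$, then $\phi_i(v)=\lambda_i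 v(\{i\})$. Monotonicity axiom: if $v$ is monotone, then $\phi_i(v)\ge 0$. *)

theory Defs
  imports Complex_Main
begin

definition simplicial_complex_on :: "nat \<Rightarrow> nat set set \<Rightarrow> bool" where
  "simplicial_complex_on n \<Delta> \<longleftrightarrow>
     \<Delta> \<subseteq> Pow {1..n} \<and> (\<forall>T\<in>\<Delta>. \<forall>S. S \<subseteq> T \<longrightarrow> S \<in> \<Delta>)"

text \<open>A game is a function on \<open>\<Delta>\<close>. It is represented by its extension by zero to all
  sets of naturals, so that each function on \<open>\<Delta>\<close> has exactly one representative and the
  vector space operations are pointwise.\<close>

definition games :: "nat set set \<Rightarrow> (nat set \<Rightarrow> real) set" where
  "games \<Delta> = {v. v {} = 0 \<and> (\<forall>S. S \<notin> \<Delta> \<longrightarrow> v S = 0)}"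

definition link :: "nat set set \<Rightarrow> nat \<Rightarrow> nat set set" where
  "link \<Delta> i = {T \<in> \<Delta>. i \<notin> T \<and> T \<union> {i} \<in> \<Delta>}"

definition dummy_player :: "nat set set \<Rightarrow> nat \<Rightarrow> (nat set \<Rightarrow> real) \<Rightarrow> bool" where
  "dummy_player \<Delta> i v \<longleftrightarrow>
     (\<forall>S. i \<notin> S \<longrightarrow> S \<union> {i} \<in> \<Delta> \<longrightarrow> v (S \<union> {i}) = v S + v {i})"

definition monotone_game :: "nat set set \<Rightarrow> (nat set \<Rightarrow> real) \<Rightarrow> bool" where
  "monotone_game \<Delta> v \<longleftrightarrow> (\<forall>T\<in>\<Delta>. \<forall>S. S \<subseteq> T \<longrightarrow> v S \<le> v T)"

text \<open>An individual value is a function \<open>games \<Delta> \<rightarrow> \<real>\<close>; the notions below only look at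
  \<open>\<phi>\<close> on \<open>games \<Delta>\<close>.\<close>

definition linear_value :: "nat set set \<Rightarrow> ((nat set \<Rightarrow> real) \<Rightarrow> real) \<Rightarrow> bool" where
  "linear_value \<Delta> \<phi> \<longleftrightarrow>
     (\<forall>v\<in>games \<Delta>. \<forall>w\<in>games \<Delta>. \<phi> (\<lambda>S. v S + w S) = \<phi> v + \<phi> w) \<and>
     (\<forall>c. \<forall>v\<in>games \<Delta>. \<phi> (\<lambda>S. c * v S) = c * \<phi> v)"

definition dummy_axiom ::
  "nat set set \<Rightarrow> nat \<Rightarrow> real \<Rightarrow> ((nat set \<Rightarrow> real) \<Rightarrow> real) \<Rightarrow> bool" where
  "dummy_axiom \<Delta> i l \<phi> \<longleftrightarrow>
     (\<forall>v\<in>games \<Delta>. dummy_player \<Delta> i v \<longrightarrow> \<phi> v = l * v {i})"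

definition monotonicity_axiom ::
  "nat set set \<Rightarrow> ((nat set \<Rightarrow> real) \<Rightarrow> real) \<Rightarrow> bool" where
  "monotonicity_axiom \<Delta> \<phi> \<longleftrightarrow> (\<forall>v\<in>games \<Delta>. monotone_game \<Delta> v \<longrightarrow> 0 \<le> \<phi> v)"

end

theory Submission
  imports Defs
begin

text \<open>For \<open>T\<close> in the link of \<open>i\<close>, let \<open>w T\<close> be the game that is \<open>1\<close> on the faces strictly
  containing \<open>T\<close> and \<open>0\<close> elsewhere. It is monotone, and the only face of the link at which
  \<open>i\<close> has a nonzero marginal contribution is \<open>T\<close> itself, where it is \<open>1\<close>. Subtracting from
  a game \<open>v\<close> the combination of the \<open>w T\<close> weighted by the marginal contributions of \<open>i\<close> to
  \<open>v\<close> leaves a game in which \<open>i\<close> is a dummy of worth \<open>0\<close>, so linearity and the dummy axiom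
  give the formula with \<open>p T = \<phi> (w T) \<ge> 0\<close>. The total weight is found by evaluating at
  the game that is \<open>1\<close> exactly on the faces containing \<open>i\<close>.\<close>

definition strict_superset_game :: "nat set set \<Rightarrow> nat set \<Rightarrow> nat set \<Rightarrow> real" where
  "strict_superset_game \<Delta> T S = of_bool (S \<in> \<Delta> \<and> T \<subset> S)"

lemma finite_link:
  assumes "simplicial_complex_on n \<Delta>"
  shows "finite (link \<Delta> i)"
proof (rule finite_subset)
  show "link \<Delta> i \<subseteq> Pow {1..n}"
    using assms by (auto simp: link_def simplicial_complex_on_def)
qed simp

lemma in_link_iff:
  assumes "simplicial_complex_on n \<Delta>"
  shows "S \<in> link \<Delta> i \<longleftrightarrow> i \<notin> S \<and> S \<union> {i} \<in> \<Delta>"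
  using assms unfolding link_def simplicial_complex_on_def by blast

text \<open>Strictness of the inclusion makes the worth of \<open>{}\<close> vanish even for
  \<open>T = {}\<close>.\<close>

lemma strict_superset_game_in_games: "strict_superset_game \<Delta> T \<in> games \<Delta>"
  by (auto simp: games_def strict_superset_game_def)

lemma monotone_strict_superset_game:
  assumes "simplicial_complex_on n \<Delta>"
  shows "monotone_game \<Delta> (strict_superset_game \<Delta> T)"
  using assms
  by (auto simp: monotone_game_def simplicial_complex_on_def strict_superset_game_def of_bool_def)

text \<open>Since \<open>i\<close> lies in neither \<open>S\<close> nor \<open>T\<close>, the
  inclusion of \<open>T\<close> in \<open>S \<union> {i}\<close> is strict as soon as
  \<open>T \<subseteq> S\<close>. Adding \<open>i\<close> therefore changes the worth only in the
  boundary case \<open>S = T\<close>.\<close>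

lemma marginal_strict_superset_game:
  assumes "S \<in> link \<Delta> i" "T \<in> link \<Delta> i"
  shows "strict_superset_game \<Delta> T (S \<union> {i}) - strict_superset_game \<Delta> T S = of_bool (S = T)"
proof -
  have "T \<subset> S \<union> {i} \<longleftrightarrow> T \<subset> S \<or> S = T"
    using assms by (auto simp: link_def)
  then show ?thesis
    using assms by (auto simp: link_def strict_superset_game_def)
qed

lemma games_add: "v \<in> games \<Delta> \<Longrightarrow> w \<in> games \<Delta> \<Longrightarrow> (\<lambda>S. v S + w S) \<in> games \<Delta>"
  by (simp add: games_def)

lemma games_scale: "v \<in> games \<Delta> \<Longrightarrow> (\<lambda>S. c * v S) \<in> games \<Delta>"
  by (simp add: games_def)

lemma games_sum:
  assumes "\<And>T. T \<in> A \<Longrightarrow> w T \<in> games \<Delta>"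
  shows "(\<lambda>S. \<Sum>T\<in>A. c T * w T S) \<in> games \<Delta>"
  using assms by (simp add: games_def)

lemma linear_value_add:
  assumes "linear_value \<Delta> \<phi>" "v \<in> games \<Delta>" "w \<in> games \<Delta>"
  shows "\<phi> (\<lambda>S. v S + w S) = \<phi> v + \<phi> w"
  using assms by (simp add: linear_value_def)

lemma linear_value_scale:
  assumes "linear_value \<Delta> \<phi>" "v \<in> games \<Delta>"
  shows "\<phi> (\<lambda>S. c * v S) = c * \<phi> v"
  using assms by (simp add: linear_value_def)

lemma linear_value_sum:
  assumes "linear_value \<Delta> \<phi>" "finite A" "\<And>T. T \<in> A \<Longrightarrow> w T \<in> games \<Delta>"
  shows "\<phi> (\<lambda>S. \<Sum>T\<in>A. c T * w T S) = (\<Sum>T\<in>A. c T * \<phi> (w T))"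
  using assms(2,3)
proof (induction A rule: finite_induct)
  case empty
  \<comment> \<open>The empty sum is the zero game, and homogeneity with factor 0 sends it to
    0.\<close>
  have zero: "(\<lambda>S. 0) \<in> games \<Delta>"
    by (simp add: games_def)
  show ?case
    using linear_value_scale[OF assms(1) zero, of 0] by simp
next
  case (insert T A)
  have "\<phi> (\<lambda>S. \<Sum>T\<in>insert T A. c T * w T S)
      = \<phi> (\<lambda>S. c T * w T S + (\<Sum>T\<in>A. c T * w T S))"
    using insert.hyps by simp
  also have "\<dots> = \<phi> (\<lambda>S. c T * w T S) + \<phi> (\<lambda>S. \<Sum>T\<in>A. c T * w T S)"
    using insert.prems by (intro linear_value_add[OF assms(1)] games_scale games_sum) auto
  also have "\<phi> (\<lambda>S. c T * w T S) = c T * \<phi> (w T)"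
    using insert.prems by (intro linear_value_scale[OF assms(1)]) auto
  finally show ?case
    using insert by simp
qed

lemma value_eq_sum_marginals:
  assumes \<Delta>: "simplicial_complex_on n \<Delta>" and i: "{i} \<in> \<Delta>"
    and lin: "linear_value \<Delta> \<phi>" and dummy: "dummy_axiom \<Delta> i l \<phi>" and v: "v \<in> games \<Delta>"
  shows "\<phi> v = (\<Sum>T\<in>link \<Delta> i. \<phi> (strict_superset_game \<Delta> T) * (v (T \<union> {i}) - v T))"
proof -
  define m where "m T = v (T \<union> {i}) - v T" for T
  define u where "u = (\<lambda>S. \<Sum>T\<in>link \<Delta> i. m T * strict_superset_game \<Delta> T S)"
  \<comment> \<open>The difference \<open>v - u\<close> is written with a factor -1 to match the two
    clauses of \<open>linear_value\<close>.\<close>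
  define d where "d = (\<lambda>S. v S + (-1) * u S)"
  have u: "u \<in> games \<Delta>"
    unfolding u_def by (intro games_sum strict_superset_game_in_games)
  then have u': "(\<lambda>S. (-1) * u S) \<in> games \<Delta>"
    by (rule games_scale)
  have d: "d \<in> games \<Delta>"
    unfolding d_def by (intro games_add v u')
  have u_marginal: "u (S \<union> {i}) - u S = m S" if S: "S \<in> link \<Delta> i" for S
  proof -
    have "u (S \<union> {i}) - u S = (\<Sum>T\<in>link \<Delta> i. m T *
        (strict_superset_game \<Delta> T (S \<union> {i}) - strict_superset_game \<Delta> T S))"
      by (simp add: u_def sum_subtractf right_diff_distrib)
    also have "\<dots> = (\<Sum>T\<in>link \<Delta> i. if S = T then m T else 0)"
      using marginal_strict_superset_game[OF S] by (intro sum.cong) auto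
    finally show ?thesis
      using S finite_link[OF \<Delta>] by simp
  qed
  have d_marginal: "d (S \<union> {i}) = d S" if "S \<in> link \<Delta> i" for S
    using u_marginal[OF that] by (simp add: d_def m_def)
  \<comment> \<open>As \<open>{i}\<close> is a face, \<open>{}\<close> is in the link, so
    \<open>d {i} = d {} = 0\<close>. With this worth, being a dummy for \<open>d\<close> means
    exactly that all marginal contributions on the link vanish.\<close>
  have "d {i} = 0"
    using d_marginal[of "{}"] i d by (simp add: in_link_iff[OF \<Delta>] games_def)
  moreover from this have "dummy_player \<Delta> i d"
    using d_marginal by (simp add: dummy_player_def in_link_iff[OF \<Delta>])
  ultimately have "\<phi> d = 0"
    using dummy d by (simp add: dummy_axiom_def)
  moreover have "\<phi> d = \<phi> v + \<phi> (\<lambda>S. (-1) * u S)"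
    unfolding d_def by (rule linear_value_add[OF lin v u'])
  moreover have "\<phi> (\<lambda>S. (-1) * u S) = (-1) * \<phi> u"
    by (rule linear_value_scale[OF lin u])
  ultimately have "\<phi> v = \<phi> u"
    by simp
  also have "\<dots> = (\<Sum>T\<in>link \<Delta> i. m T * \<phi> (strict_superset_game \<Delta> T))"
    unfolding u_def
    by (intro linear_value_sum[OF lin] finite_link[OF \<Delta>] strict_superset_game_in_games)
  finally show ?thesis
    by (simp add: m_def mult.commute)
qed

lemma sum_weights_eq:
  assumes \<Delta>: "simplicial_complex_on n \<Delta>" and i: "{i} \<in> \<Delta>" and dummy: "dummy_axiom \<Delta> i l \<phi>"
    and eq: "\<forall>v\<in>games \<Delta>. \<phi> v = (\<Sum>T\<in>link \<Delta> i. p T * (v (T \<union> {i}) - v T))"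
  shows "(\<Sum>T\<in>link \<Delta> i. p T) = l"
proof -
  define v :: "nat set \<Rightarrow> real" where "v S = of_bool (i \<in> S \<and> S \<in> \<Delta>)" for S
  have v: "v \<in> games \<Delta>"
    by (auto simp: v_def games_def)
  \<comment> \<open>Every marginal contribution of \<open>i\<close> to this game is 1, and so is
    \<open>v {i}\<close> because \<open>{i}\<close> is a face. The dummy axiom thus returns
    \<open>l\<close>, while the formula returns the total weight.\<close>
  have "dummy_player \<Delta> i v"
    using i by (simp add: dummy_player_def v_def)
  then have "l = \<phi> v"
    using dummy v i by (simp add: dummy_axiom_def v_def)
  also have "\<dots> = (\<Sum>T\<in>link \<Delta> i. p T * (v (T \<union> {i}) - v T))"
    using eq v by blast
  also have "\<dots> = (\<Sum>T\<in>link \<Delta> i. p T)"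
    by (intro sum.cong) (auto simp: v_def link_def)
  finally show ?thesis by simp
qed

text \<open>Marginal contributions are linear in the game; as the formula speaks only of games,
  closure of \<open>games \<Delta>\<close> under the operations is what lets it apply to sums and
  multiples.\<close>

lemma linear_value_sum_marginals:
  assumes eq: "\<forall>v\<in>games \<Delta>. \<phi> v = (\<Sum>T\<in>link \<Delta> i. p T * (v (T \<union> {i}) - v T))"
  shows "linear_value \<Delta> \<phi>"
  unfolding linear_value_def
proof (intro conjI ballI allI)
  fix v w assume "v \<in> games \<Delta>" "w \<in> games \<Delta>"
  then show "\<phi> (\<lambda>S. v S + w S) = \<phi> v + \<phi> w"
    using games_add[of v \<Delta> w]
    by (simp add: eq sum.distrib[symmetric]) (simp add: algebra_simps)
next
  fix c v assume "v \<in> games \<Delta>"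
  then show "\<phi> (\<lambda>S. c * v S) = c * \<phi> v"
    using games_scale[of v \<Delta> c]
    by (simp add: eq sum_distrib_left) (simp add: algebra_simps)
qed

text \<open>For a dummy player every marginal contribution on the link is \<open>v {i}\<close>,
  which factors out of the sum.\<close>

lemma dummy_axiom_sum_marginals:
  assumes eq: "\<forall>v\<in>games \<Delta>. \<phi> v = (\<Sum>T\<in>link \<Delta> i. p T * (v (T \<union> {i}) - v T))"
  shows "dummy_axiom \<Delta> i (\<Sum>T\<in>link \<Delta> i. p T) \<phi>"
  unfolding dummy_axiom_def
proof (intro ballI impI)
  fix v assume v: "v \<in> games \<Delta>" and dummy: "dummy_player \<Delta> i v"
  have "\<phi> v = (\<Sum>T\<in>link \<Delta> i. p T * (v (T \<union> {i}) - v T))"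
    using eq v by blast
  also have "\<dots> = (\<Sum>T\<in>link \<Delta> i. p T * v {i})"
    using dummy by (intro sum.cong) (auto simp: dummy_player_def link_def)
  finally show "\<phi> v = (\<Sum>T\<in>link \<Delta> i. p T) * v {i}"
    by (simp add: sum_distrib_right)
qed

lemma monotonicity_axiom_sum_marginals:
  assumes eq: "\<forall>v\<in>games \<Delta>. \<phi> v = (\<Sum>T\<in>link \<Delta> i. p T * (v (T \<union> {i}) - v T))"
    and nonneg: "\<forall>T\<in>link \<Delta> i. 0 \<le> p T"
  shows "monotonicity_axiom \<Delta> \<phi>"
  unfolding monotonicity_axiom_def
proof (intro ballI impI)
  fix v assume v: "v \<in> games \<Delta>" and mono: "monotone_game \<Delta> v"
  have "v T \<le> v (T \<union> {i})" if "T \<in> link \<Delta> i" for T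
    using mono that unfolding monotone_game_def link_def by blast
  then have "0 \<le> (\<Sum>T\<in>link \<Delta> i. p T * (v (T \<union> {i}) - v T))"
    using nonneg by (intro sum_nonneg mult_nonneg_nonneg) auto
  then show "0 \<le> \<phi> v"
    using eq v by simp
qed

theorem theorem2p1:
  fixes n i :: nat
    and \<Delta> :: "nat set set"
    and l :: real
    and \<phi> :: "(nat set \<Rightarrow> real) \<Rightarrow> real"
  assumes "simplicial_complex_on n \<Delta>"
    and "i \<in> {1..n}"
    and "{i} \<in> \<Delta>"
    and "0 \<le> l" and "l \<le> 1"
  shows "linear_value \<Delta> \<phi> \<and> dummy_axiom \<Delta> i l \<phi> \<and> monotonicity_axiom \<Delta> \<phi> \<longleftrightarrow>
    (\<exists>p :: nat set \<Rightarrow> real.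
       (\<forall>T\<in>link \<Delta> i. 0 \<le> p T) \<and>
       (\<Sum>T\<in>link \<Delta> i. p T) = l \<and>
       (\<forall>v\<in>games \<Delta>. \<phi> v = (\<Sum>T\<in>link \<Delta> i. p T * (v (T \<union> {i}) - v T))))"
    (is "?axioms \<longleftrightarrow> (\<exists>p. ?weights p)")
proof
  assume ax: ?axioms
  define p where "p T = \<phi> (strict_superset_game \<Delta> T)" for T
  have eq: "\<forall>v\<in>games \<Delta>. \<phi> v = (\<Sum>T\<in>link \<Delta> i. p T * (v (T \<union> {i}) - v T))"
    using value_eq_sum_marginals assms(1,3) ax unfolding p_def by blast
  \<comment> \<open>The game behind \<open>p T\<close> is monotone for every set \<open>T\<close>,
    in the link or not.\<close>
  have "0 \<le> p T" for T
    using ax monotone_strict_superset_game[OF assms(1)] strict_superset_game_in_games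
    unfolding p_def monotonicity_axiom_def by blast
  then have "?weights p"
    using eq sum_weights_eq[OF assms(1,3) _ eq] ax by blast
  then show "\<exists>p. ?weights p"
    by blast
next
  assume "\<exists>p. ?weights p"
  then show ?axioms
    using linear_value_sum_marginals dummy_axiom_sum_marginals monotonicity_axiom_sum_marginals
    by blast
qed

end
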